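(* Let $\rho$ and $\sigma$ be two states on $\mathcal{H}_{[n]}=\bigotimes_{i=1}^n\mathcal{H}_i$, and let $T\subseteq[n]$. In the $n$-qubit parallelized SWAP test of $\rho$ and $\sigma$, we have $$s_T(\rho,\sigma)=p(\mathbf{z}),$$ where $\mathbf{z}\in\mathbb{Z}_2^n$ is the bitstring with $\mathrm{supp}(\mathbf{z})=T^c$, and $s_T(\rho,\sigma)$ is the shadow enumerator of $\rho$ and $\sigma$ on $T$.
   Context: $[n]=\{1,\dots,n\}$. $\mathcal{H}_1,\dots,\mathcal{H}_n$ are finite-dimensional complex Hilbert spaces (for this result the local dimensions are arbitrary and need not be equal), and $\mathcal{H}_{[n]}=\bigotimes_{i=1}^n\mathcal{H}_i$. A state on $\mathcal{H}_{[n]}$ is a positive semidefinite operator of trace $1$. For $S\subseteq[n]$, $S^c=[n]\setminus S$ and $\rho_S=\mathrm{Tr}_{S^c}\rho$ is the reduced state (partial trace over the factors in $S^c$); for $S=\emptyset$, $\mathrm{Tr}(\rho_\emptyset\sigma_\emptyset)=1$. For $\mathbf{z}=(z_1,\dots,z_n)\in\mathbb{Z}_2^n$, $\mathrm{supp}(\mathbf{z})=\{i: z_i\neq 0\}$. The (normalized) shadow enumerator of $\rho$ and $\sigma$ on $T\subseteq[n]$ is $$s_T(\rho,\sigma)=\frac{1}{2^n}\sum_{S\subseteq[n]}(-1)^{|S\cap T^c|}\,\mathrm{Tr}(\rho_S\sigma_S).$$ The $n$-qubit parallelized SWAP test of $\rho$ and $\sigma$ is the following circuit. There are $n$ ancilla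 qubits $A_1,\dots,A_n$, and registers $B_1,\dots,B_n$ and $C_1,\dots,C_n$ with $B_i\cong C_i\cong\mathcal{H}_i$. The initial state is $(|0\rangle\langle 0|)^{\otimes n}\otimes\rho\otimes\sigma$, with $\rho$ on $B_1\cdots B_n$ and $\sigma$ on $C_1\cdots C_n$. Apply a Hadamard gate $H$ to each ancilla $A_i$; then for each $i$ apply the controlled-SWAP gate with control $A_i$ which swaps $B_i$ and $C_i$ when $A_i$ is in state $|1\rangle$ (and acts trivially when $A_i$ is in state $|0\rangle$); then apply $H$ to each ancilla again; finally measure all ancillas in the computational basis. $p(\mathbf{z})$ denotes the probability of obtaining outcome $\mathbf{z}\in\mathbb{Z}_2^n$. *)

theory Defs
  imports Complex_Main "HOL-Library.FuncSet"
begin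

text \<open>
  A finite-dimensional Hilbert space is given by an orthonormal basis: the space with label \<open>r\<close>
  is the one with basis \<open>{..<D r}\<close>, and the tensor product over a finite label set \<open>R\<close> has
  the product basis \<open>tbasis R D\<close>. An operator on it is its matrix in this basis. The values of
  the matrix outside \<open>tbasis R D\<close> are irrelevant, since all sums below range over that set.
\<close>

type_synonym 'r op = "('r \<Rightarrow> nat) \<Rightarrow> ('r \<Rightarrow> nat) \<Rightarrow> complex"

definition tbasis :: "'r set \<Rightarrow> ('r \<Rightarrow> nat) \<Rightarrow> ('r \<Rightarrow> nat) set" where
  "tbasis R D = (\<Pi>\<^sub>E r\<in>R. {..<D r})"

definition op_mult :: "'r set \<Rightarrow> ('r \<Rightarrow> nat) \<Rightarrow> 'r op \<Rightarrow> 'r op \<Rightarrow> 'r op" where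
  "op_mult R D M N = (\<lambda>x y. \<Sum>w\<in>tbasis R D. M x w * N w y)"

definition op_adjoint :: "'r op \<Rightarrow> 'r op" where
  "op_adjoint M = (\<lambda>x y. cnj (M y x))"

definition op_trace :: "'r set \<Rightarrow> ('r \<Rightarrow> nat) \<Rightarrow> 'r op \<Rightarrow> complex" where
  "op_trace R D M = (\<Sum>x\<in>tbasis R D. M x x)"

definition op_hermitian :: "'r set \<Rightarrow> ('r \<Rightarrow> nat) \<Rightarrow> 'r op \<Rightarrow> bool" where
  "op_hermitian R D M \<longleftrightarrow> (\<forall>x\<in>tbasis R D. \<forall>y\<in>tbasis R D. op_adjoint M x y = M x y)"

definition op_psd :: "'r set \<Rightarrow> ('r \<Rightarrow> nat) \<Rightarrow> 'r op \<Rightarrow> bool" where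
  "op_psd R D M \<longleftrightarrow> op_hermitian R D M \<and>
     (\<forall>\<psi> :: ('r \<Rightarrow> nat) \<Rightarrow> complex.
        0 \<le> Re (\<Sum>x\<in>tbasis R D. \<Sum>y\<in>tbasis R D. cnj (\<psi> x) * M x y * \<psi> y))"

definition is_state :: "'r set \<Rightarrow> ('r \<Rightarrow> nat) \<Rightarrow> 'r op \<Rightarrow> bool" where
  "is_state R D \<rho> \<longleftrightarrow> op_psd R D \<rho> \<and> op_trace R D \<rho> = 1"

text \<open>
  The partial trace over the factors in \<open>R - S\<close>; an operator on the factors in \<open>S\<close>. Here
  \<open>override_on x w (R - S)\<close> is the basis label that is \<open>w\<close> on \<open>R - S\<close> and \<open>x\<close> on \<open>S\<close>. For
  \<open>S = {}\<close> this is the \<open>1 \<times> 1\<close> matrix with entry \<open>op_trace R D \<rho>\<close>, so two states \<open>\<rho>\<close> and \<open>\<sigma>\<close>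
  have \<open>Tr (\<rho>\<^sub>S \<sigma>\<^sub>S) = 1\<close> in that case.
\<close>

definition reduced :: "'r set \<Rightarrow> ('r \<Rightarrow> nat) \<Rightarrow> 'r set \<Rightarrow> 'r op \<Rightarrow> 'r op" where
  "reduced R D S \<rho> =
     (\<lambda>x y. \<Sum>w\<in>tbasis (R - S) D. \<rho> (override_on x w (R - S)) (override_on y w (R - S)))"

definition shadow_enumerator ::
  "nat \<Rightarrow> (nat \<Rightarrow> nat) \<Rightarrow> nat set \<Rightarrow> nat op \<Rightarrow> nat op \<Rightarrow> complex" where
  "shadow_enumerator n d T \<rho> \<sigma> =
     1 / 2 ^ n * (\<Sum>S\<in>Pow {1..n}. (- 1) ^ card (S \<inter> ({1..n} - T)) *
        op_trace S d (op_mult S d (reduced {1..n} d S \<rho>) (reduced {1..n} d S \<sigma>)))"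

definition bitstrings :: "nat \<Rightarrow> (nat \<Rightarrow> nat) set" where
  "bitstrings n = (\<Pi>\<^sub>E i\<in>{1..n}. {0, 1})"

definition bit_supp :: "nat \<Rightarrow> (nat \<Rightarrow> nat) \<Rightarrow> nat set" where
  "bit_supp n z = {i \<in> {1..n}. z i \<noteq> 0}"

lemma ex1_bitstring_supp:
  assumes "U \<subseteq> {1..n}"
  shows "\<exists>!z. z \<in> bitstrings n \<and> bit_supp n z = U"
proof (rule ex1I[of _ "\<lambda>i\<in>{1..n}. if i \<in> U then 1 else 0"])
  show "(\<lambda>i\<in>{1..n}. if i \<in> U then 1 else 0) \<in> bitstrings n \<and>
      bit_supp n (\<lambda>i\<in>{1..n}. if i \<in> U then 1 else 0) = U"
    using assms by (auto simp: bitstrings_def bit_supp_def)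
next
  fix z assume z: "z \<in> bitstrings n \<and> bit_supp n z = U"
  show "z = (\<lambda>i\<in>{1..n}. if i \<in> U then 1 else 0)"
  proof
    fix i
    show "z i = (\<lambda>i\<in>{1..n}. if i \<in> U then 1 else 0) i"
    proof (cases "i \<in> {1..n}")
      case True
      then have "z i \<in> {0, 1}" "i \<in> U \<longleftrightarrow> z i \<noteq> 0"
        using z by (auto simp: bitstrings_def bit_supp_def PiE_iff)
      then show ?thesis using True by auto
    next
      case False
      have "z i = undefined"
        using z PiE_arb[OF _ False, of z "\<lambda>_. {0, 1}"] by (simp add: bitstrings_def)
      with False show ?thesis by (simp only: restrict_apply if_False)
    qed
  qed
qed

text \<open>The registers \<open>A\<^sub>i\<close> (ancilla qubits), \<open>B\<^sub>i\<close>, \<open>C\<^sub>i\<close> of the parallelized SWAP test.\<close>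

datatype reg = Anc nat | BReg nat | CReg nat

definition regs :: "nat \<Rightarrow> reg set" where
  "regs n = Anc ` {1..n} \<union> BReg ` {1..n} \<union> CReg ` {1..n}"

fun reg_dim :: "(nat \<Rightarrow> nat) \<Rightarrow> reg \<Rightarrow> nat" where
  "reg_dim d (Anc i) = 2"
| "reg_dim d (BReg i) = d i"
| "reg_dim d (CReg i) = d i"

text \<open>\<open>|0\<rangle>\<langle>0|\<^sup>\<otimes>\<^sup>n \<otimes> \<rho> \<otimes> \<sigma>\<close>: an entry of a tensor product is the product of the entries.\<close>

definition swap_test_init :: "nat \<Rightarrow> nat op \<Rightarrow> nat op \<Rightarrow> reg op" where
  "swap_test_init n \<rho> \<sigma> = (\<lambda>x y.
     (\<Prod>i\<in>{1..n}. if x (Anc i) = 0 \<and> y (Anc i) = 0 then 1 else 0) *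
     \<rho> (\<lambda>i\<in>{1..n}. x (BReg i)) (\<lambda>i\<in>{1..n}. y (BReg i)) *
     \<sigma> (\<lambda>i\<in>{1..n}. x (CReg i)) (\<lambda>i\<in>{1..n}. y (CReg i)))"

text \<open>The operator \<open>G\<close> on the factors in \<open>K\<close>, tensored with the identity on those in \<open>R - K\<close>.\<close>

definition local_op :: "'r set \<Rightarrow> 'r set \<Rightarrow> 'r op \<Rightarrow> 'r op" where
  "local_op R K G = (\<lambda>x y.
     if \<forall>r\<in>R - K. x r = y r then G (restrict x K) (restrict y K) else 0)"

definition hadamard_gate :: "nat \<Rightarrow> nat \<Rightarrow> reg op" where
  "hadamard_gate n i = local_op (regs n) {Anc i}
     (\<lambda>u v. (- 1) ^ (u (Anc i) * v (Anc i)) / complex_of_real (sqrt 2))"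

definition cswap_gate :: "nat \<Rightarrow> nat \<Rightarrow> reg op" where
  "cswap_gate n i = local_op (regs n) {Anc i, BReg i, CReg i}
     (\<lambda>u v. if u (Anc i) = v (Anc i) \<and>
               (if v (Anc i) = 1
                then u (BReg i) = v (CReg i) \<and> u (CReg i) = v (BReg i)
                else u (BReg i) = v (BReg i) \<and> u (CReg i) = v (CReg i))
            then 1 else 0)"

definition apply_gate :: "'r set \<Rightarrow> ('r \<Rightarrow> nat) \<Rightarrow> 'r op \<Rightarrow> 'r op \<Rightarrow> 'r op" where
  "apply_gate R D U \<rho> = op_mult R D (op_mult R D U \<rho>) (op_adjoint U)"

text \<open>The gates in temporal order.\<close>

definition swap_test_gates :: "nat \<Rightarrow> reg op list" where
  "swap_test_gates n =
     map (hadamard_gate n) [1..<n + 1] @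
     map (cswap_gate n) [1..<n + 1] @
     map (hadamard_gate n) [1..<n + 1]"

definition swap_test_final :: "nat \<Rightarrow> (nat \<Rightarrow> nat) \<Rightarrow> nat op \<Rightarrow> nat op \<Rightarrow> reg op" where
  "swap_test_final n d \<rho> \<sigma> =
     fold (apply_gate (regs n) (reg_dim d)) (swap_test_gates n) (swap_test_init n \<rho> \<sigma>)"

text \<open>The projector \<open>|z\<rangle>\<langle>z|\<close> on the ancillas, tensored with the identity on the other registers.\<close>

definition outcome_projector :: "nat \<Rightarrow> (nat \<Rightarrow> nat) \<Rightarrow> reg op" where
  "outcome_projector n z = local_op (regs n) (Anc ` {1..n})
     (\<lambda>u v. if \<forall>i\<in>{1..n}. u (Anc i) = z i \<and> v (Anc i) = z i then 1 else 0)"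

text \<open>The Born rule; the trace is real because the projector and the final state are hermitian.\<close>

definition swap_test_prob ::
  "nat \<Rightarrow> (nat \<Rightarrow> nat) \<Rightarrow> nat op \<Rightarrow> nat op \<Rightarrow> (nat \<Rightarrow> nat) \<Rightarrow> real" where
  "swap_test_prob n d \<rho> \<sigma> z =
     Re (op_trace (regs n) (reg_dim d)
       (op_mult (regs n) (reg_dim d) (outcome_projector n z) (swap_test_final n d \<rho> \<sigma>)))"

end

theory Submission imports Defs begin

text \<open>
  With \<open>W\<^sub>A\<close> the operator swapping \<open>B\<^sub>i\<close> and \<open>C\<^sub>i\<close> for \<open>i \<in> A\<close> and \<open>U\<close> the support of \<open>z\<close>, the
  branch of outcome \<open>z\<close> is the image of \<open>\<rho> \<otimes> \<sigma>\<close> under \<open>2\<^sup>-\<^sup>n \<Sum>\<^sub>A (-1)\<^bsup>|A \<inter> U|\<^esup> W\<^sub>A\<close>. Since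
  \<open>W\<^sub>B W\<^sub>A = W\<^sub>S\<close> for the symmetric difference \<open>S\<close> of \<open>A\<close> and \<open>B\<close>, and \<open>Tr (W\<^sub>S (\<rho> \<otimes> \<sigma>)) = Tr (\<rho>\<^sub>S \<sigma>\<^sub>S)\<close>,
  the probability is \<open>4\<^sup>-\<^sup>n \<Sum>\<^sub>A \<Sum>\<^sub>B (-1)\<^bsup>|S \<inter> U|\<^esup> Tr (\<rho>\<^sub>S \<sigma>\<^sub>S)\<close>. Every \<open>S\<close> arises from \<open>2\<^sup>n\<close> pairs.
\<close>

section \<open>Basis labels of the register space\<close>

lemma finite_tbasis: "finite R \<Longrightarrow> finite (tbasis R D)"
  by (simp add: tbasis_def finite_PiE)

lemma finite_regs: "finite (regs n)"
  by (simp add: regs_def)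

lemma tbasis_eqI:
  assumes "x \<in> tbasis R D" "y \<in> tbasis R D" "\<And>r. r \<in> R \<Longrightarrow> x r = y r"
  shows "x = y"
  using assms by (auto simp: tbasis_def intro: PiE_ext)

lemma ball_regs:
  "(\<forall>r\<in>regs n. P r) \<longleftrightarrow> (\<forall>i\<in>{1..n}. P (Anc i) \<and> P (BReg i) \<and> P (CReg i))"
  by (auto simp: regs_def)

lemma tbasis_regs_iff:
  "x \<in> tbasis (regs n) (reg_dim d) \<longleftrightarrow>
     (\<forall>i\<in>{1..n}. x (Anc i) < 2 \<and> x (BReg i) < d i \<and> x (CReg i) < d i) \<and>
     (\<forall>r. r \<notin> regs n \<longrightarrow> x r = undefined)"
  unfolding tbasis_def PiE_iff ball_regs by (auto simp: extensional_def)

lemma in_regs_iff: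
  "Anc i \<in> regs n \<longleftrightarrow> i \<in> {1..n}" "BReg i \<in> regs n \<longleftrightarrow> i \<in> {1..n}"
  "CReg i \<in> regs n \<longleftrightarrow> i \<in> {1..n}"
  by (auto simp: regs_def)

section \<open>Matrix entries under a single gate\<close>

text \<open>The adjoint of a real matrix is its transpose, so conjugation splits into one row sum
  for \<open>x\<close> and one for \<open>y\<close>. Both kinds of gate are real with sparse
  rows.\<close>

lemma apply_gate_entry:
  assumes "\<And>u v. cnj (U u v) = U u v"
  shows "apply_gate R D U M x y = (\<Sum>v\<in>tbasis R D. U y v * (\<Sum>w\<in>tbasis R D. U x w * M w v))"
  using assms by (simp add: apply_gate_def op_mult_def op_adjoint_def mult.commute)

text \<open>The identity on the other registers kills every label that differs from \<open>x\<close>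
  away from \<open>Anc i\<close>; one term per value of that bit survives.\<close>

lemma hadamard_row_sum:
  assumes "i \<in> {1..n}" "x \<in> tbasis (regs n) (reg_dim d)"
  shows "(\<Sum>w\<in>tbasis (regs n) (reg_dim d). hadamard_gate n i x w * g w) =
    (\<Sum>a\<in>{0, 1}. (- 1) ^ (x (Anc i) * a) / complex_of_real (sqrt 2) * g (x(Anc i := a)))"
proof -
  let ?X = "tbasis (regs n) (reg_dim d)" and ?f = "\<lambda>a. x(Anc i := a)"
  have sub: "?f ` {0, 1} \<subseteq> ?X"
    using assms by (auto simp: tbasis_regs_iff in_regs_iff)
  have inj: "inj_on ?f {0, 1}"
    by (auto simp: inj_on_def dest: fun_cong[of _ _ "Anc i"])
  have zero: "hadamard_gate n i x w = 0" if w: "w \<in> ?X - ?f ` {0, 1}" for w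
  proof -
    \<comment> \<open>Compare \<open>w\<close> with the label in the image that has the same bit at
      \<open>Anc i\<close>: they differ somewhere, hence at a register where the gate is the
      identity.\<close>
    have "w (Anc i) < 2" using w assms(1) by (auto simp: tbasis_regs_iff)
    then have "?f (w (Anc i)) \<in> ?f ` {0, 1}" by (intro imageI) auto
    then have "w \<noteq> ?f (w (Anc i))" "?f (w (Anc i)) \<in> ?X" using w sub by auto
    then have "\<exists>r\<in>regs n. w r \<noteq> ?f (w (Anc i)) r" using w tbasis_eqI by blast
    then obtain r where "r \<in> regs n" "w r \<noteq> ?f (w (Anc i)) r" by blast
    then have "r \<in> regs n - {Anc i}" "x r \<noteq> w r" by (auto split: if_splits)
    then show ?thesis by (auto simp: hadamard_gate_def local_op_def)
  qed
  have "(\<Sum>w\<in>?X. hadamard_gate n i x w * g w) = (\<Sum>w\<in>?f ` {0, 1}. hadamard_gate n i x w * g w)"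
    using sub zero by (intro sum.mono_neutral_right) (auto simp: finite_tbasis finite_regs)
  also have "\<dots> = (\<Sum>a\<in>{0, 1}. hadamard_gate n i x (?f a) * g (?f a))"
    using inj by (simp add: sum.reindex)
  also have "\<dots> = (\<Sum>a\<in>{0, 1}. (- 1) ^ (x (Anc i) * a) / complex_of_real (sqrt 2) * g (?f a))"
    by (intro sum.cong) (auto simp: hadamard_gate_def local_op_def)
  finally show ?thesis .
qed

text \<open>Ancilla contents are encoded as subsets: the bits in \<open>K\<close> become the
  indicator of \<open>A\<close>, so sums over bits become sums over \<open>Pow K\<close>. Bits
  outside \<open>K\<close> stay, which lets \<open>K\<close> grow gate by gate.\<close>

definition set_anc :: "nat set \<Rightarrow> nat set \<Rightarrow> (reg \<Rightarrow> nat) \<Rightarrow> reg \<Rightarrow> nat" where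
  "set_anc K A x = (\<lambda>r. case r of
       Anc i \<Rightarrow> if i \<in> K then (if i \<in> A then 1 else 0) else x (Anc i)
     | _ \<Rightarrow> x r)"

text \<open>The permutation of basis labels that induces the swap operator
  \<open>W\<^sub>A\<close>.\<close>

definition swap_regs :: "nat set \<Rightarrow> (reg \<Rightarrow> nat) \<Rightarrow> reg \<Rightarrow> nat" where
  "swap_regs A x = (\<lambda>r. case r of
       Anc i \<Rightarrow> x (Anc i)
     | BReg i \<Rightarrow> if i \<in> A then x (CReg i) else x (BReg i)
     | CReg i \<Rightarrow> if i \<in> A then x (BReg i) else x (CReg i))"

lemma set_anc_simps [simp]:
  "set_anc K A x (Anc i) = (if i \<in> K then (if i \<in> A then 1 else 0) else x (Anc i))"
  "set_anc K A x (BReg i) = x (BReg i)"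
  "set_anc K A x (CReg i) = x (CReg i)"
  by (simp_all add: set_anc_def)

lemma swap_regs_simps [simp]:
  "swap_regs A x (Anc i) = x (Anc i)"
  "swap_regs A x (BReg i) = (if i \<in> A then x (CReg i) else x (BReg i))"
  "swap_regs A x (CReg i) = (if i \<in> A then x (BReg i) else x (CReg i))"
  by (simp_all add: swap_regs_def)

lemma fun_reg_eqI:
  assumes "\<And>i. f (Anc i) = g (Anc i)" "\<And>i. f (BReg i) = g (BReg i)" "\<And>i. f (CReg i) = g (CReg i)"
  shows "f = g"
proof
  show "f r = g r" for r using assms by (cases r) auto
qed

lemma set_anc_in_tbasis:
  assumes "x \<in> tbasis (regs n) (reg_dim d)" "K \<subseteq> {1..n}"
  shows "set_anc K A x \<in> tbasis (regs n) (reg_dim d)"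
proof -
  have "set_anc K A x r = undefined" if "r \<notin> regs n" for r
    using that assms by (cases r) (auto simp: tbasis_regs_iff in_regs_iff)
  then show ?thesis using assms by (auto simp: tbasis_regs_iff)
qed

text \<open>The registers \<open>BReg i\<close> and \<open>CReg i\<close> have the same dimension
  \<open>d i\<close>, so exchanging their values respects the bounds.\<close>

lemma swap_regs_in_tbasis:
  assumes "x \<in> tbasis (regs n) (reg_dim d)" "A \<subseteq> {1..n}"
  shows "swap_regs A x \<in> tbasis (regs n) (reg_dim d)"
proof -
  have "swap_regs A x r = undefined" if "r \<notin> regs n" for r
    using that assms by (cases r) (auto simp: tbasis_regs_iff in_regs_iff)
  then show ?thesis using assms by (auto simp: tbasis_regs_iff)
qed

text \<open>The gate is a permutation matrix: the only nonzero entry of row \<open>x\<close> is a 1,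
  at \<open>x\<close> with its pair swapped if its control bit is 1.\<close>

lemma cswap_row_sum:
  assumes "i \<in> {1..n}" "x \<in> tbasis (regs n) (reg_dim d)"
  shows "(\<Sum>w\<in>tbasis (regs n) (reg_dim d). cswap_gate n i x w * g w) =
    g (swap_regs (if x (Anc i) = 1 then {i} else {}) x)"
proof -
  let ?X = "tbasis (regs n) (reg_dim d)"
  define s where "s = swap_regs (if x (Anc i) = 1 then {i} else {}) x"
  have s: "s \<in> ?X" using assms by (auto simp: s_def intro: swap_regs_in_tbasis)
  have one: "cswap_gate n i x s = 1"
  proof -
    have "x r = s r" if "r \<notin> {Anc i, BReg i, CReg i}" for r
      using that by (cases r) (auto simp: s_def)
    then show ?thesis by (auto simp: cswap_gate_def local_op_def s_def)
  qed
  have zero: "cswap_gate n i x w = 0" if w: "w \<in> ?X" "w \<noteq> s" for w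
  proof (rule ccontr)
    assume nz: "cswap_gate n i x w \<noteq> 0"
    have off: "x r = w r" if "r \<in> regs n - {Anc i, BReg i, CReg i}" for r
      using nz that by (auto simp: cswap_gate_def local_op_def split: if_splits)
    have on: "x (Anc i) = w (Anc i)" "if w (Anc i) = 1
        then x (BReg i) = w (CReg i) \<and> x (CReg i) = w (BReg i)
        else x (BReg i) = w (BReg i) \<and> x (CReg i) = w (CReg i)"
      using nz by (auto simp: cswap_gate_def local_op_def split: if_splits)
    have "w r = s r" if "r \<in> regs n" for r
    proof (cases "r \<in> {Anc i, BReg i, CReg i}")
      case True
      then show ?thesis using on by (auto simp: s_def split: if_splits)
    next
      case False
      then show ?thesis using off[of r] that by (cases r) (auto simp: s_def)
    qed
    then show False using w s tbasis_eqI by blast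
  qed
  have "(\<Sum>w\<in>?X. cswap_gate n i x w * g w) = (\<Sum>w\<in>{s}. cswap_gate n i x w * g w)"
    using s zero by (intro sum.mono_neutral_right) (auto simp: finite_tbasis finite_regs)
  then show ?thesis using one by (simp add: s_def)
qed

lemma apply_hadamard:
  assumes "i \<in> {1..n}" "x \<in> tbasis (regs n) (reg_dim d)" "y \<in> tbasis (regs n) (reg_dim d)"
  shows "apply_gate (regs n) (reg_dim d) (hadamard_gate n i) M x y =
    (\<Sum>a\<in>{0, 1}. \<Sum>b\<in>{0, 1}. (- 1) ^ (x (Anc i) * a + y (Anc i) * b) / 2 *
       M (x(Anc i := a)) (y(Anc i := b)))"
proof -
  have real: "cnj (hadamard_gate n i u v) = hadamard_gate n i u v" for u v
    by (simp add: hadamard_gate_def local_op_def)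
  have sqrt: "complex_of_real (sqrt 2) * complex_of_real (sqrt 2) = 2"
    by (simp flip: of_real_mult)
  show ?thesis
    unfolding apply_gate_entry[OF real] hadamard_row_sum[OF assms(1,2)] hadamard_row_sum[OF assms(1,3)]
    by (simp add: field_simps power_add sqrt)
qed

text \<open>Conjugation by a permutation matrix relabels rows and columns. Each side obeys its own
  control bit, so off-diagonal ancilla blocks can see different swaps.\<close>

lemma apply_cswap:
  assumes "i \<in> {1..n}" "x \<in> tbasis (regs n) (reg_dim d)" "y \<in> tbasis (regs n) (reg_dim d)"
  shows "apply_gate (regs n) (reg_dim d) (cswap_gate n i) M x y =
    M (swap_regs (if x (Anc i) = 1 then {i} else {}) x)
      (swap_regs (if y (Anc i) = 1 then {i} else {}) y)"
proof -
  have real: "cnj (cswap_gate n i u v) = cswap_gate n i u v" for u v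
    by (simp add: cswap_gate_def local_op_def)
  show ?thesis
    unfolding apply_gate_entry[OF real] cswap_row_sum[OF assms(1,2)] cswap_row_sum[OF assms(1,3)] ..
qed

section \<open>Layers of gates\<close>

lemma sum_Pow_insert:
  assumes "finite A" "k \<notin> A"
  shows "(\<Sum>S\<in>Pow (insert k A). g S) = (\<Sum>S\<in>Pow A. g S) + (\<Sum>S\<in>Pow A. g (insert k S))"
proof -
  have "inj_on (insert k) (Pow A)"
    using assms(2) by (intro inj_onI) (auto simp: insert_eq_iff)
  then show ?thesis using assms
    by (subst Pow_insert, subst sum.union_disjoint) (auto simp: sum.reindex)
qed

text \<open>Each gate adds a choice of row bit and of column bit and a factor 1/2. \<open>A\<close>
  and \<open>B\<close> collect the ancillas where the chosen bit is 1; only these contribute to the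
  sign.\<close>

lemma fold_hadamard:
  assumes "k \<le> n" "x \<in> tbasis (regs n) (reg_dim d)" "y \<in> tbasis (regs n) (reg_dim d)"
  shows "fold (apply_gate (regs n) (reg_dim d)) (map (hadamard_gate n) [1..<k + 1]) M x y =
    (\<Sum>A\<in>Pow {1..k}. \<Sum>B\<in>Pow {1..k}.
       (- 1) ^ ((\<Sum>i\<in>A. x (Anc i)) + (\<Sum>i\<in>B. y (Anc i))) / 2 ^ k *
       M (set_anc {1..k} A x) (set_anc {1..k} B y))"
  using assms
\<comment> \<open>The last gate evaluates the earlier layer at labels with a changed ancilla bit, so
  \<open>x\<close> and \<open>y\<close> must vary.\<close>
proof (induction k arbitrary: x y)
  case 0
  have "set_anc {} {} u = u" for u by (rule fun_reg_eqI) auto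
  then show ?case by simp
next
  case (Suc k)
  define F where "F = fold (apply_gate (regs n) (reg_dim d)) (map (hadamard_gate n) [1..<k + 1]) M"
  define K where "K = {1..k}"
  have i: "Suc k \<in> {1..n}" and k: "k \<le> n" using Suc.prems by auto
  have insK: "{1..Suc k} = insert (Suc k) K" and K: "finite K" "Suc k \<notin> K"
    by (auto simp: K_def)
  have upd: "u(Anc (Suc k) := a) \<in> tbasis (regs n) (reg_dim d)"
    if "u \<in> tbasis (regs n) (reg_dim d)" "a < 2" for u a
    using that i by (auto simp: tbasis_regs_iff in_regs_iff)
  \<comment> \<open>Fixing bit \<open>Suc k\<close> first and then those in \<open>K\<close>
    overwrites all of \<open>insert (Suc k) K\<close>; the value 1 puts \<open>Suc k\<close> into
    the set.\<close>
  have setK: "set_anc K A (u(Anc (Suc k) := 0)) = set_anc (insert (Suc k) K) A u"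
    "set_anc K A (u(Anc (Suc k) := Suc 0)) = set_anc (insert (Suc k) K) (insert (Suc k) A) u"
    if "A \<in> Pow K" for A u
    using that K by (auto intro!: fun_reg_eqI)
  have sumK: "(\<Sum>i\<in>A. (u(Anc (Suc k) := a)) (Anc i)) = (\<Sum>i\<in>A. u (Anc i))"
    "(\<Sum>i\<in>insert (Suc k) A. u (Anc i)) = u (Anc (Suc k)) + (\<Sum>i\<in>A. u (Anc i))"
    if "A \<in> Pow K" for A u a
  proof -
    have "Suc k \<notin> A" "finite A" using that K finite_subset by auto
    then show "(\<Sum>i\<in>A. (u(Anc (Suc k) := a)) (Anc i)) = (\<Sum>i\<in>A. u (Anc i))"
      "(\<Sum>i\<in>insert (Suc k) A. u (Anc i)) = u (Anc (Suc k)) + (\<Sum>i\<in>A. u (Anc i))"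
      by (auto intro!: sum.cong)
  qed
  have IH: "F (x(Anc (Suc k) := a)) (y(Anc (Suc k) := b)) =
    (\<Sum>A\<in>Pow K. \<Sum>B\<in>Pow K.
       (- 1) ^ ((\<Sum>i\<in>A. x (Anc i)) + (\<Sum>i\<in>B. y (Anc i))) / 2 ^ k *
       M (set_anc K A (x(Anc (Suc k) := a))) (set_anc K B (y(Anc (Suc k) := b))))"
    if "a < 2" "b < 2" for a b
    unfolding F_def K_def Suc.IH[OF k upd[OF Suc.prems(2) that(1)] upd[OF Suc.prems(3) that(2)]]
    by (intro sum.cong refl) (simp only: sumK flip: K_def)
  have "fold (apply_gate (regs n) (reg_dim d)) (map (hadamard_gate n) [1..<Suc k + 1]) M x y =
    apply_gate (regs n) (reg_dim d) (hadamard_gate n (Suc k)) F x y"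
    by (simp add: F_def)
  also have "\<dots> = (\<Sum>a\<in>{0, 1}. \<Sum>b\<in>{0, 1}.
       (- 1) ^ (x (Anc (Suc k)) * a + y (Anc (Suc k)) * b) / 2 *
       F (x(Anc (Suc k) := a)) (y(Anc (Suc k) := b)))"
    by (rule apply_hadamard[OF i Suc.prems(2,3)])
  \<comment> \<open>The four values of \<open>(a, b)\<close> match the four cases of whether
    \<open>Suc k\<close> lies in \<open>A\<close> and in \<open>B\<close>.\<close>
  also have "\<dots> = (\<Sum>A\<in>Pow {1..Suc k}. \<Sum>B\<in>Pow {1..Suc k}.
       (- 1) ^ ((\<Sum>i\<in>A. x (Anc i)) + (\<Sum>i\<in>B. y (Anc i))) / 2 ^ Suc k *
       M (set_anc {1..Suc k} A x) (set_anc {1..Suc k} B y))"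
    unfolding insK
    by (simp add: K IH sum_Pow_insert setK sumK sum_distrib_left sum_divide_distrib sum.distrib
        power_add mult_ac
        del: fun_upd_apply Pow_iff cong: sum.cong)
  finally show ?case .
qed

text \<open>Swaps leave the control bits alone and act on disjoint pairs, so the layer swaps exactly
  the pairs whose control bit is 1, separately for rows and columns.\<close>

lemma fold_cswap:
  assumes "k \<le> n" "x \<in> tbasis (regs n) (reg_dim d)" "y \<in> tbasis (regs n) (reg_dim d)"
  shows "fold (apply_gate (regs n) (reg_dim d)) (map (cswap_gate n) [1..<k + 1]) M x y =
    M (swap_regs {i \<in> {1..k}. x (Anc i) = 1} x) (swap_regs {i \<in> {1..k}. y (Anc i) = 1} y)"
  using assms
proof (induction k arbitrary: x y)
  case 0
  have "swap_regs {} u = u" for u by (rule fun_reg_eqI) auto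
  then show ?case by simp
next
  case (Suc k)
  let ?s = "\<lambda>u. swap_regs (if u (Anc (Suc k)) = 1 then {Suc k} else {}) u"
  have i: "Suc k \<in> {1..n}" and k: "k \<le> n" using Suc.prems by auto
  have mem: "?s u \<in> tbasis (regs n) (reg_dim d)" if "u \<in> tbasis (regs n) (reg_dim d)" for u
    using that i by (auto intro: swap_regs_in_tbasis)
  have eq: "swap_regs {i \<in> {1..k}. ?s u (Anc i) = 1} (?s u) =
      swap_regs {i \<in> {1..Suc k}. u (Anc i) = 1} u" for u
    by (rule fun_reg_eqI) (auto simp: le_Suc_eq)
  have "fold (apply_gate (regs n) (reg_dim d)) (map (cswap_gate n) [1..<Suc k + 1]) M x y =
    apply_gate (regs n) (reg_dim d) (cswap_gate n (Suc k))
      (fold (apply_gate (regs n) (reg_dim d)) (map (cswap_gate n) [1..<k + 1]) M) x y"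
    by simp
  also have "\<dots> = fold (apply_gate (regs n) (reg_dim d)) (map (cswap_gate n) [1..<k + 1]) M (?s x) (?s y)"
    by (rule apply_cswap[OF i Suc.prems(2,3)])
  also have "\<dots> = M (swap_regs {i \<in> {1..k}. ?s x (Anc i) = 1} (?s x))
      (swap_regs {i \<in> {1..k}. ?s y (Anc i) = 1} (?s y))"
    by (rule Suc.IH[OF k mem[OF Suc.prems(2)] mem[OF Suc.prems(3)]])
  finally show ?case unfolding eq .
qed

section \<open>The state before the measurement\<close>

text \<open>This is \<rho> \<otimes> \<sigma> as a function of full register labels that ignores the
  ancillas, so it can be evaluated at relabelled arguments directly.\<close>

definition prod_op :: "nat \<Rightarrow> nat op \<Rightarrow> nat op \<Rightarrow> reg op" where
  "prod_op n \<rho> \<sigma> = (\<lambda>x y.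
     \<rho> (\<lambda>i\<in>{1..n}. x (BReg i)) (\<lambda>i\<in>{1..n}. y (BReg i)) *
     \<sigma> (\<lambda>i\<in>{1..n}. x (CReg i)) (\<lambda>i\<in>{1..n}. y (CReg i)))"

lemma prod_op_swap_set_anc:
  "prod_op n \<rho> \<sigma> (swap_regs A' (set_anc K A x)) (swap_regs B' (set_anc L B y)) =
   prod_op n \<rho> \<sigma> (swap_regs A' x) (swap_regs B' y)"
  by (simp add: prod_op_def cong: if_cong)

text \<open>The initial state vanishes unless all ancilla bits are 0, so only
  \<open>A = B = {}\<close> survives, with sign 1. The result no longer depends on the ancilla bits
  of \<open>x\<close> and \<open>y\<close>.\<close>

lemma first_hadamard_layer:
  assumes "x \<in> tbasis (regs n) (reg_dim d)" "y \<in> tbasis (regs n) (reg_dim d)"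
  shows "fold (apply_gate (regs n) (reg_dim d)) (map (hadamard_gate n) [1..<n + 1])
      (swap_test_init n \<rho> \<sigma>) x y = prod_op n \<rho> \<sigma> x y / 2 ^ n"
proof -
  have init: "swap_test_init n \<rho> \<sigma> (set_anc {1..n} A x) (set_anc {1..n} B y) =
      (if A = {} then if B = {} then prod_op n \<rho> \<sigma> x y else 0 else 0)"
    if AB: "A \<in> Pow {1..n}" "B \<in> Pow {1..n}" for A B
  proof (cases "A = {} \<and> B = {}")
    case True
    then show ?thesis by (simp add: swap_test_init_def prod_op_def cong: restrict_cong)
  next
    case False
    then obtain i where "i \<in> {1..n}" "i \<in> A \<or> i \<in> B" using AB by blast
    then have "(\<Prod>i\<in>{1..n}. if set_anc {1..n} A x (Anc i) = 0 \<and> set_anc {1..n} B y (Anc i) = 0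
        then 1 else 0 :: complex) = 0"
      by (intro prod_zero) (auto intro!: bexI[of _ i])
    then show ?thesis using False by (auto simp: swap_test_init_def)
  qed
  have "(\<Sum>A\<in>Pow {1..n}. \<Sum>B\<in>Pow {1..n}.
       (- 1) ^ ((\<Sum>i\<in>A. x (Anc i)) + (\<Sum>i\<in>B. y (Anc i))) / 2 ^ n *
       swap_test_init n \<rho> \<sigma> (set_anc {1..n} A x) (set_anc {1..n} B y)) =
    (\<Sum>A\<in>Pow {1..n}. \<Sum>B\<in>Pow {1..n}.
       if A = {} then if B = {} then prod_op n \<rho> \<sigma> x y / 2 ^ n else 0 else 0)"
  proof (intro sum.cong refl)
    fix A B assume AB: "A \<in> Pow {1..n}" "B \<in> Pow {1..n}"
    show "(- 1) ^ ((\<Sum>i\<in>A. x (Anc i)) + (\<Sum>i\<in>B. y (Anc i))) / 2 ^ n *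
        swap_test_init n \<rho> \<sigma> (set_anc {1..n} A x) (set_anc {1..n} B y) =
      (if A = {} then if B = {} then prod_op n \<rho> \<sigma> x y / 2 ^ n else 0 else 0)"
      unfolding init[OF AB] by simp
  qed
  also have "\<dots> = (\<Sum>A\<in>Pow {1..n}. if A = {} then prod_op n \<rho> \<sigma> x y / 2 ^ n else 0)"
    by (intro sum.cong refl) simp
  also have "\<dots> = prod_op n \<rho> \<sigma> x y / 2 ^ n"
    by simp
  finally show ?thesis
    unfolding fold_hadamard[OF order.refl assms] .
qed

text \<open>The layers are peeled from the last: it sums over earlier ancilla contents
  \<open>A\<close> and \<open>B\<close>, which control the swaps on either side of \<rho> \<otimes>
  \<sigma>. Each Hadamard layer contributes \<open>1 / 2 ^ n\<close>.\<close>

lemma swap_test_final_entry: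
  assumes "x \<in> tbasis (regs n) (reg_dim d)" "y \<in> tbasis (regs n) (reg_dim d)"
  shows "swap_test_final n d \<rho> \<sigma> x y =
    (\<Sum>A\<in>Pow {1..n}. \<Sum>B\<in>Pow {1..n}.
       (- 1) ^ ((\<Sum>i\<in>A. x (Anc i)) + (\<Sum>i\<in>B. y (Anc i))) / 4 ^ n *
       prod_op n \<rho> \<sigma> (swap_regs A x) (swap_regs B y))"
proof -
  let ?a = "fold (apply_gate (regs n) (reg_dim d))" and ?X = "tbasis (regs n) (reg_dim d)"
  have anc: "{i \<in> {1..n}. set_anc {1..n} A u (Anc i) = 1} = A" if "A \<in> Pow {1..n}" for A u
    using that by auto
  have mid: "?a (map (cswap_gate n) [1..<n + 1])
      (?a (map (hadamard_gate n) [1..<n + 1]) (swap_test_init n \<rho> \<sigma>))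
      (set_anc {1..n} A x) (set_anc {1..n} B y) =
      prod_op n \<rho> \<sigma> (swap_regs A x) (swap_regs B y) / 2 ^ n"
    if A: "A \<in> Pow {1..n}" and B: "B \<in> Pow {1..n}" for A B
  proof -
    have s: "set_anc {1..n} A x \<in> ?X" "set_anc {1..n} B y \<in> ?X"
      using assms by (simp_all add: set_anc_in_tbasis)
    then have "swap_regs A (set_anc {1..n} A x) \<in> ?X" "swap_regs B (set_anc {1..n} B y) \<in> ?X"
      using A B by (auto intro!: swap_regs_in_tbasis)
    then show ?thesis
      unfolding fold_cswap[OF order.refl s] anc[OF A] anc[OF B]
      by (simp only: first_hadamard_layer prod_op_swap_set_anc)
  qed
  have four: "(4::complex) ^ n = 2 ^ n * 2 ^ n"
    by (simp flip: power_mult_distrib)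
  show ?thesis
    unfolding swap_test_final_def swap_test_gates_def fold_append comp_def
      fold_hadamard[OF order.refl assms]
    by (intro sum.cong refl) (simp only: mid four times_divide_eq_left times_divide_eq_right divide_divide_eq_left)
qed

section \<open>Measurement and the labels of an outcome\<close>

text \<open>Parametrizes the labels with ancilla content \<open>z\<close> by pairs of labels of the
  system. Restriction to \<open>regs n\<close> supplies the value \<open>undefined\<close> required
  elsewhere.\<close>

definition regs_join :: "nat \<Rightarrow> (nat \<Rightarrow> nat) \<Rightarrow> (nat \<Rightarrow> nat) \<times> (nat \<Rightarrow> nat) \<Rightarrow> reg \<Rightarrow> nat" where
  "regs_join n z = (\<lambda>(b, c). \<lambda>r\<in>regs n. case r of Anc i \<Rightarrow> z i | BReg i \<Rightarrow> b i | CReg i \<Rightarrow> c i)"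

lemma regs_join_simps:
  assumes "i \<in> {1..n}"
  shows "regs_join n z (b, c) (Anc i) = z i" "regs_join n z (b, c) (BReg i) = b i"
    "regs_join n z (b, c) (CReg i) = c i"
  using assms by (auto simp: regs_join_def in_regs_iff)

lemma bij_betw_regs_join:
  assumes z: "z \<in> bitstrings n"
  shows "bij_betw (regs_join n z) (tbasis {1..n} d \<times> tbasis {1..n} d)
    {x \<in> tbasis (regs n) (reg_dim d). \<forall>i\<in>{1..n}. x (Anc i) = z i}"
proof (rule bij_betw_byWitness[where f' = "\<lambda>x. (\<lambda>i\<in>{1..n}. x (BReg i), \<lambda>i\<in>{1..n}. x (CReg i))"])
  show "\<forall>p\<in>tbasis {1..n} d \<times> tbasis {1..n} d.
      (\<lambda>i\<in>{1..n}. regs_join n z p (BReg i), \<lambda>i\<in>{1..n}. regs_join n z p (CReg i)) = p"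
    by (auto simp: regs_join_simps tbasis_def PiE_iff extensional_def fun_eq_iff)
  show "regs_join n z ` (tbasis {1..n} d \<times> tbasis {1..n} d) \<subseteq>
      {x \<in> tbasis (regs n) (reg_dim d). \<forall>i\<in>{1..n}. x (Anc i) = z i}"
  proof -
    \<comment> \<open>Being a bitstring is what keeps \<open>z\<close> within the ancilla dimension
      2.\<close>
    have "z i < 2" if "i \<in> {1..n}" for i using z PiE_mem[OF _ that, of z "\<lambda>_. {0, 1}"] by (auto simp: bitstrings_def)
    then show ?thesis
      by (auto simp: tbasis_regs_iff regs_join_simps) (auto simp: regs_join_def tbasis_def)
  qed
  show "(\<lambda>x. (\<lambda>i\<in>{1..n}. x (BReg i), \<lambda>i\<in>{1..n}. x (CReg i))) `
      {x \<in> tbasis (regs n) (reg_dim d). \<forall>i\<in>{1..n}. x (Anc i) = z i} \<subseteq>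
      tbasis {1..n} d \<times> tbasis {1..n} d"
    by (auto simp: tbasis_regs_iff tbasis_def[of _ d])
  show "\<forall>x\<in>{x \<in> tbasis (regs n) (reg_dim d). \<forall>i\<in>{1..n}. x (Anc i) = z i}.
      regs_join n z (\<lambda>i\<in>{1..n}. x (BReg i), \<lambda>i\<in>{1..n}. x (CReg i)) = x"
  proof
    fix x assume x: "x \<in> {x \<in> tbasis (regs n) (reg_dim d). \<forall>i\<in>{1..n}. x (Anc i) = z i}"
    show "regs_join n z (\<lambda>i\<in>{1..n}. x (BReg i), \<lambda>i\<in>{1..n}. x (CReg i)) = x"
    proof
      fix r
      show "regs_join n z (\<lambda>i\<in>{1..n}. x (BReg i), \<lambda>i\<in>{1..n}. x (CReg i)) r = x r"
        using x by (cases r) (auto simp: regs_join_def in_regs_iff tbasis_regs_iff)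
    qed
  qed
qed

text \<open>The projector is diagonal with entries 0 and 1, so the trace keeps the diagonal entries
  of \<open>M\<close> with ancilla content \<open>z\<close>.\<close>

lemma trace_outcome_projector:
  "op_trace (regs n) (reg_dim d) (op_mult (regs n) (reg_dim d) (outcome_projector n z) M) =
    (\<Sum>x | x \<in> tbasis (regs n) (reg_dim d) \<and> (\<forall>i\<in>{1..n}. x (Anc i) = z i). M x x)"
proof -
  let ?X = "tbasis (regs n) (reg_dim d)"
  have P: "outcome_projector n z x w = (if w = x then if \<forall>i\<in>{1..n}. x (Anc i) = z i then 1 else 0 else 0)"
    if x: "x \<in> ?X" and w: "w \<in> ?X" for x w
  proof (cases "w = x")
    case True
    then show ?thesis by (simp add: outcome_projector_def local_op_def)
  next
    case False
    then obtain r where "r \<in> regs n" "w r \<noteq> x r" using tbasis_eqI[OF w x] by auto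
    \<comment> \<open>If \<open>w\<close> and \<open>x\<close> differ at an ancilla, they cannot
      both equal \<open>z\<close> there; if they differ elsewhere, the identity factor
      vanishes.\<close>
    then have "\<not> ((\<forall>r\<in>regs n - Anc ` {1..n}. x r = w r) \<and>
      (\<forall>i\<in>{1..n}. x (Anc i) = z i \<and> w (Anc i) = z i))"
      by (cases "r \<in> Anc ` {1..n}") (force, force)
    then show ?thesis using False by (auto simp: outcome_projector_def local_op_def)
  qed
  have fin: "finite ?X" by (simp add: finite_tbasis finite_regs)
  have "op_trace (regs n) (reg_dim d) (op_mult (regs n) (reg_dim d) (outcome_projector n z) M) =
    (\<Sum>x\<in>?X. \<Sum>w\<in>?X. if w = x then (if \<forall>i\<in>{1..n}. x (Anc i) = z i then M x x else 0) else 0)"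
    unfolding op_trace_def op_mult_def by (intro sum.cong refl) (auto simp: P)
  also have "\<dots> = (\<Sum>x\<in>?X. if \<forall>i\<in>{1..n}. x (Anc i) = z i then M x x else 0)"
    using fin by (intro sum.cong refl) (simp add: sum.delta)
  also have "\<dots> = (\<Sum>x | x \<in> ?X \<and> (\<forall>i\<in>{1..n}. x (Anc i) = z i). M x x)"
    using fin by (simp add: sum.inter_filter)
  finally show ?thesis .
qed

section \<open>Overlaps of reduced states as traces of partial swaps\<close>

definition reduced_overlap :: "'r set \<Rightarrow> ('r \<Rightarrow> nat) \<Rightarrow> 'r set \<Rightarrow> 'r op \<Rightarrow> 'r op \<Rightarrow> complex" where
  "reduced_overlap R D S \<rho> \<sigma> = op_trace S D (op_mult S D (reduced R D S \<rho>) (reduced R D S \<sigma>))"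

text \<open>The factorization of the space over \<open>R\<close> into those over \<open>S\<close>
  and \<open>R - S\<close>, at the level of basis labels.\<close>

lemma bij_betw_tbasis_split:
  assumes "S \<subseteq> R"
  shows "bij_betw (\<lambda>(x, w). override_on x w (R - S)) (tbasis S D \<times> tbasis (R - S) D) (tbasis R D)"
proof (rule bij_betw_byWitness[where f' = "\<lambda>u. (restrict u S, restrict u (R - S))"])
  show "\<forall>p\<in>tbasis S D \<times> tbasis (R - S) D. (restrict (case p of (x, w) \<Rightarrow> override_on x w (R - S)) S,
      restrict (case p of (x, w) \<Rightarrow> override_on x w (R - S)) (R - S)) = p"
    by (auto simp: tbasis_def PiE_iff extensional_def fun_eq_iff override_on_def)
  show "\<forall>u\<in>tbasis R D. (case (restrict u S, restrict u (R - S)) of (x, w) \<Rightarrow> override_on x w (R - S)) = u"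
    using assms by (auto simp: tbasis_def PiE_iff extensional_def fun_eq_iff override_on_def)
  show "(\<lambda>(x, w). override_on x w (R - S)) ` (tbasis S D \<times> tbasis (R - S) D) \<subseteq> tbasis R D"
    using assms by (auto simp: tbasis_def PiE_iff extensional_def override_on_def)
  show "(\<lambda>u. (restrict u S, restrict u (R - S))) ` tbasis R D \<subseteq> tbasis S D \<times> tbasis (R - S) D"
    using assms by (auto simp: tbasis_def PiE_iff)
qed

lemma sum_tbasis_split:
  assumes "S \<subseteq> R"
  shows "(\<Sum>u\<in>tbasis R D. g u) =
    (\<Sum>x\<in>tbasis S D. \<Sum>w\<in>tbasis (R - S) D. g (override_on x w (R - S)))"
  by (subst sum.reindex_bij_betw[OF bij_betw_tbasis_split[OF assms], symmetric])
    (simp add: sum.cartesian_product split_def)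

text \<open>The right side is the trace of \<open>W\<^sub>S\<close> against \<rho> \<otimes>
  \<sigma>. Writing \<open>b\<close> as \<open>(x, w)\<close> and \<open>c\<close> as
  \<open>(y, v)\<close> along \<open>S\<close> and \<open>R - S\<close>, the sums over
  \<open>w\<close> and \<open>v\<close> become the two partial traces.\<close>

lemma reduced_overlap_eq_sum:
  assumes "S \<subseteq> R"
  shows "reduced_overlap R D S \<rho> \<sigma> = (\<Sum>b\<in>tbasis R D. \<Sum>c\<in>tbasis R D.
    \<rho> b (override_on b c S) * \<sigma> c (override_on c b S))"
proof -
  let ?S = "tbasis S D" and ?W = "tbasis (R - S) D"
  let ?o = "\<lambda>x w. override_on x w (R - S)"
  \<comment> \<open>Membership of \<open>x\<close> and \<open>y\<close> matters only outside
    \<open>R\<close>, where both are \<open>undefined\<close>.\<close>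
  have mix: "override_on (?o x w) (?o y v) S = ?o y w" if "x \<in> ?S" "y \<in> ?S" for x y w v
    using that assms by (auto simp: tbasis_def PiE_iff extensional_def fun_eq_iff override_on_def)
  have "(\<Sum>b\<in>tbasis R D. \<Sum>c\<in>tbasis R D. \<rho> b (override_on b c S) * \<sigma> c (override_on c b S)) =
    (\<Sum>x\<in>?S. \<Sum>w\<in>?W. \<Sum>y\<in>?S. \<Sum>v\<in>?W. \<rho> (?o x w) (?o y w) * \<sigma> (?o y v) (?o x v))"
    unfolding sum_tbasis_split[OF assms] by (intro sum.cong refl) (simp add: mix)
  also have "\<dots> = (\<Sum>x\<in>?S. \<Sum>y\<in>?S. \<Sum>w\<in>?W. \<Sum>v\<in>?W. \<rho> (?o x w) (?o y w) * \<sigma> (?o y v) (?o x v))"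
    by (intro sum.cong refl sum.swap)
  also have "\<dots> = reduced_overlap R D S \<rho> \<sigma>"
    by (simp add: reduced_overlap_def op_trace_def op_mult_def reduced_def sum_product)
  finally show ?thesis ..
qed

text \<open>Reduced operators inherit hermiticity, so conjugation transposes both factors, and
  exchanging the two summation indices restores the trace.\<close>

lemma cnj_reduced_overlap:
  assumes "S \<subseteq> R" "op_hermitian R D \<rho>" "op_hermitian R D \<sigma>"
  shows "cnj (reduced_overlap R D S \<rho> \<sigma>) = reduced_overlap R D S \<rho> \<sigma>"
proof -
  have mem: "override_on x w (R - S) \<in> tbasis R D" if "x \<in> tbasis S D" "w \<in> tbasis (R - S) D" for x w
    using bij_betw_apply[OF bij_betw_tbasis_split[OF assms(1)]] that by fastforce
  have cnj_red: "cnj (reduced R D S \<tau> x y) = reduced R D S \<tau> y x"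
    if "op_hermitian R D \<tau>" "x \<in> tbasis S D" "y \<in> tbasis S D" for \<tau> x y
    using that mem unfolding reduced_def op_hermitian_def op_adjoint_def
    by (auto intro!: sum.cong)
  have "cnj (reduced_overlap R D S \<rho> \<sigma>) =
    (\<Sum>x\<in>tbasis S D. \<Sum>y\<in>tbasis S D. reduced R D S \<rho> y x * reduced R D S \<sigma> x y)"
    using assms by (simp add: reduced_overlap_def op_trace_def op_mult_def cnj_red)
  also have "\<dots> = reduced_overlap R D S \<rho> \<sigma>"
    unfolding reduced_overlap_def op_trace_def op_mult_def by (rule sum.swap)
  finally show ?thesis .
qed

section \<open>Composition of swaps and symmetric differences\<close>

lemma bij_betw_swap_regs:
  assumes "A \<subseteq> {1..n}"
  shows "bij_betw (swap_regs A) {x \<in> tbasis (regs n) (reg_dim d). \<forall>i\<in>{1..n}. x (Anc i) = z i}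
    {x \<in> tbasis (regs n) (reg_dim d). \<forall>i\<in>{1..n}. x (Anc i) = z i}"
proof -
  have "swap_regs A (swap_regs A x) = x" for x by (rule fun_reg_eqI) auto
  then show ?thesis using assms
    by (intro bij_betw_byWitness[where f' = "swap_regs A"]) (auto simp: swap_regs_in_tbasis)
qed

text \<open>Substituting \<open>swap_regs A x\<close> for \<open>x\<close> leaves a swap on the symmetric difference only.\<close>

lemma sum_prod_op_swap:
  assumes "A \<subseteq> {1..n}" "B \<subseteq> {1..n}" "z \<in> bitstrings n"
  shows "(\<Sum>x | x \<in> tbasis (regs n) (reg_dim d) \<and> (\<forall>i\<in>{1..n}. x (Anc i) = z i).
      prod_op n \<rho> \<sigma> (swap_regs A x) (swap_regs B x)) =
    reduced_overlap {1..n} d (sym_diff A B) \<rho> \<sigma>"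
proof -
  let ?X = "{x \<in> tbasis (regs n) (reg_dim d). \<forall>i\<in>{1..n}. x (Anc i) = z i}" and ?S = "sym_diff A B"
  have S: "?S \<subseteq> {1..n}" using assms by auto
  \<comment> \<open>The symmetric difference of \<open>?S\<close> and \<open>A\<close> is
    \<open>B\<close>, and exchanging a pair twice does nothing.\<close>
  have swap: "swap_regs B x = swap_regs ?S (swap_regs A x)" for x
    by (rule fun_reg_eqI) auto
  have join: "(\<lambda>i\<in>{1..n}. regs_join n z (b, c) (BReg i)) = b"
    "(\<lambda>i\<in>{1..n}. regs_join n z (b, c) (CReg i)) = c"
    "(\<lambda>i\<in>{1..n}. if i \<in> ?S then regs_join n z (b, c) (CReg i) else regs_join n z (b, c) (BReg i)) =
      override_on b c ?S"
    "(\<lambda>i\<in>{1..n}. if i \<in> ?S then regs_join n z (b, c) (BReg i) else regs_join n z (b, c) (CReg i)) =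
      override_on c b ?S"
    if "b \<in> tbasis {1..n} d" "c \<in> tbasis {1..n} d" for b c
    using that S
    by (auto simp: fun_eq_iff override_on_def tbasis_def PiE_iff extensional_def regs_join_simps)
  have "(\<Sum>x\<in>?X. prod_op n \<rho> \<sigma> (swap_regs A x) (swap_regs B x)) =
    (\<Sum>x\<in>?X. prod_op n \<rho> \<sigma> x (swap_regs ?S x))"
    unfolding swap by (rule sum.reindex_bij_betw[OF bij_betw_swap_regs[OF assms(1)]])
  also have "\<dots> = (\<Sum>p\<in>tbasis {1..n} d \<times> tbasis {1..n} d.
      prod_op n \<rho> \<sigma> (regs_join n z p) (swap_regs ?S (regs_join n z p)))"
    by (rule sum.reindex_bij_betw[OF bij_betw_regs_join[OF assms(3)], symmetric])
  also have "\<dots> = (\<Sum>(b, c)\<in>tbasis {1..n} d \<times> tbasis {1..n} d.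
      \<rho> b (override_on b c ?S) * \<sigma> c (override_on c b ?S))"
  proof (intro sum.cong refl, clarify)
    fix b c assume bc: "b \<in> tbasis {1..n} d" "c \<in> tbasis {1..n} d"
    show "prod_op n \<rho> \<sigma> (regs_join n z (b, c)) (swap_regs ?S (regs_join n z (b, c))) =
      \<rho> b (override_on b c ?S) * \<sigma> c (override_on c b ?S)"
      unfolding prod_op_def swap_regs_simps join[OF bc] ..
  qed
  also have "\<dots> = reduced_overlap {1..n} d ?S \<rho> \<sigma>"
    by (simp only: reduced_overlap_eq_sum[OF S] sum.cartesian_product)
  finally show ?thesis by simp
qed

text \<open>The right side counts the elements of \<open>A \<inter> B \<inter> U\<close> twice,
  which does not affect parity.\<close>

lemma minus_one_power_sym_diff:
  assumes "finite A" "finite B"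
  shows "(- 1 :: complex) ^ card (sym_diff A B \<inter> U) = (- 1) ^ (card (A \<inter> U) + card (B \<inter> U))"
proof -
  have fin: "finite (A \<inter> U)" "finite (B \<inter> U)" using assms by auto
  have A: "card (A \<inter> U) = card ((A - B) \<inter> U) + card (A \<inter> B \<inter> U)"
    using assms by (subst card_Un_disjoint[symmetric]) (auto intro: arg_cong[of _ _ card])
  have B: "card (B \<inter> U) = card ((B - A) \<inter> U) + card (A \<inter> B \<inter> U)"
    using assms by (subst card_Un_disjoint[symmetric]) (auto intro: arg_cong[of _ _ card])
  have AB: "card (sym_diff A B \<inter> U) = card ((A - B) \<inter> U) + card ((B - A) \<inter> U)"
    using assms by (subst card_Un_disjoint[symmetric]) (auto intro: arg_cong[of _ _ card])
  show ?thesis unfolding A B AB by (simp add: power_add)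
qed

text \<open>For fixed \<open>A\<close> the map \<open>sym_diff A\<close> is an involution of
  \<open>Pow R\<close>, so the inner sum is the same for each of the \<open>2 ^ card R\<close> sets
  \<open>A\<close>.\<close>

lemma sum_Pow_sym_diff:
  fixes g :: "'a set \<Rightarrow> complex"
  assumes "finite R"
  shows "(\<Sum>A\<in>Pow R. \<Sum>B\<in>Pow R. g (sym_diff A B)) = 2 ^ card R * (\<Sum>S\<in>Pow R. g S)"
proof -
  have "(\<Sum>B\<in>Pow R. g (sym_diff A B)) = (\<Sum>S\<in>Pow R. g S)" if "A \<in> Pow R" for A
    using that by (intro sum.reindex_bij_betw bij_betw_byWitness[where f' = "sym_diff A"]) auto
  then show ?thesis using assms by (simp add: card_Pow)
qed

theorem theorem8:
  fixes n :: nat and d :: "nat \<Rightarrow> nat" and \<rho> \<sigma> :: "nat op"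
    and T :: "nat set" and z :: "nat \<Rightarrow> nat"
  assumes "is_state {1..n} d \<rho>" and "is_state {1..n} d \<sigma>"
    and "T \<subseteq> {1..n}"
    and "z \<in> bitstrings n" and "bit_supp n z = {1..n} - T"
  shows "shadow_enumerator n d T \<rho> \<sigma> = complex_of_real (swap_test_prob n d \<rho> \<sigma> z)"
proof -
  let ?R = "{1..n}" and ?U = "{1..n} - T"
  let ?f = "\<lambda>S. reduced_overlap ?R d S \<rho> \<sigma>"
  let ?X = "{x. x \<in> tbasis (regs n) (reg_dim d) \<and> (\<forall>i\<in>?R. x (Anc i) = z i)}"
  have s: "shadow_enumerator n d T \<rho> \<sigma> = 1 / 2 ^ n * (\<Sum>S\<in>Pow ?R. (- 1) ^ card (S \<inter> ?U) * ?f S)"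
    by (simp add: shadow_enumerator_def reduced_overlap_def)
  have herm: "op_hermitian ?R d \<rho>" "op_hermitian ?R d \<sigma>"
    using assms(1,2) by (auto simp: is_state_def op_psd_def)
  \<comment> \<open>Hermiticity of both states makes the enumerator real, so taking
    \<open>Re\<close> in the Born rule loses nothing.\<close>
  have real: "cnj (shadow_enumerator n d T \<rho> \<sigma>) = shadow_enumerator n d T \<rho> \<sigma>"
    unfolding s using herm by (simp add: cnj_reduced_overlap)
  \<comment> \<open>On labels with outcome \<open>z\<close> the ancilla bits are the indicator of
    \<open>bit_supp n z\<close>, which is \<open>?U\<close>; this turns the Hadamard signs into
    those of the enumerator.\<close>
  have sign: "(\<Sum>i\<in>A. x (Anc i)) = card (A \<inter> ?U)" if "A \<in> Pow ?R" "x \<in> ?X" for A x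
  proof -
    have "x (Anc i) = (if i \<in> ?U then 1 else 0)" if "i \<in> A" for i
    proof -
      have i: "i \<in> ?R" using that \<open>A \<in> Pow ?R\<close> by auto
      then have "z i \<in> {0, 1}" "i \<in> ?U \<longleftrightarrow> z i \<noteq> 0" "x (Anc i) = z i"
        using assms(4,5) \<open>x \<in> ?X\<close> by (auto simp: bitstrings_def bit_supp_def)
      then show ?thesis by auto
    qed
    moreover have "finite A" using that finite_subset by auto
    ultimately have "(\<Sum>i\<in>A. x (Anc i)) = (\<Sum>i\<in>A \<inter> ?U. 1)"
      by (subst sum.inter_restrict) (auto intro: sum.cong)
    then show ?thesis by simp
  qed
  have "op_trace (regs n) (reg_dim d)
      (op_mult (regs n) (reg_dim d) (outcome_projector n z) (swap_test_final n d \<rho> \<sigma>)) =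
    (\<Sum>x\<in>?X. \<Sum>A\<in>Pow ?R. \<Sum>B\<in>Pow ?R.
      (- 1) ^ card (sym_diff A B \<inter> ?U) / 4 ^ n * prod_op n \<rho> \<sigma> (swap_regs A x) (swap_regs B x))"
    unfolding trace_outcome_projector
  proof (intro sum.cong refl)
    fix x assume x: "x \<in> ?X"
    then have xX: "x \<in> tbasis (regs n) (reg_dim d)" by simp
    have "(- 1 :: complex) ^ ((\<Sum>i\<in>A. x (Anc i)) + (\<Sum>i\<in>B. x (Anc i))) = (- 1) ^ card (sym_diff A B \<inter> ?U)"
      if "A \<in> Pow ?R" "B \<in> Pow ?R" for A B
    proof -
      have "finite A" "finite B" using that finite_subset by auto
      then show ?thesis
        unfolding sign[OF that(1) x] sign[OF that(2) x] by (rule minus_one_power_sym_diff[symmetric])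
    qed
    then show "swap_test_final n d \<rho> \<sigma> x x = (\<Sum>A\<in>Pow ?R. \<Sum>B\<in>Pow ?R.
      (- 1) ^ card (sym_diff A B \<inter> ?U) / 4 ^ n * prod_op n \<rho> \<sigma> (swap_regs A x) (swap_regs B x))"
      unfolding swap_test_final_entry[OF xX xX] by (intro sum.cong refl) simp
  qed
  \<comment> \<open>With \<open>A\<close> and \<open>B\<close> fixed outside, the sum over
    \<open>x\<close> is the trace of a single partial swap.\<close>
  also have "\<dots> = (\<Sum>A\<in>Pow ?R. \<Sum>B\<in>Pow ?R. \<Sum>x\<in>?X.
      (- 1) ^ card (sym_diff A B \<inter> ?U) / 4 ^ n * prod_op n \<rho> \<sigma> (swap_regs A x) (swap_regs B x))"
    by (subst sum.swap, intro sum.cong refl sum.swap)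
  also have "\<dots> = (\<Sum>A\<in>Pow ?R. \<Sum>B\<in>Pow ?R.
      (- 1) ^ card (sym_diff A B \<inter> ?U) / 4 ^ n * ?f (sym_diff A B))"
    using assms(4) by (intro sum.cong refl) (simp only: Pow_iff sum_prod_op_swap flip: sum_distrib_left)
  also have "\<dots> = 2 ^ n * (\<Sum>S\<in>Pow ?R. (- 1) ^ card (S \<inter> ?U) / 4 ^ n * ?f S)"
    by (subst sum_Pow_sym_diff) simp_all
  also have "\<dots> = 2 ^ n / 4 ^ n * (\<Sum>S\<in>Pow ?R. (- 1) ^ card (S \<inter> ?U) * ?f S)"
    by (simp add: sum_distrib_left)
  \<comment> \<open>The multiplicity \<open>2 ^ n\<close> of each set cancels one of the two
    Hadamard normalizations.\<close>
  also have "(2 :: complex) ^ n / 4 ^ n = 1 / 2 ^ n"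
    by (simp add: power_one_over flip: power_divide)
  finally have "swap_test_prob n d \<rho> \<sigma> z = Re (shadow_enumerator n d T \<rho> \<sigma>)"
    unfolding swap_test_prob_def s by simp
  then show ?thesis using real by (simp add: complex_eq_iff)
qed

end
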